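(* Let $\rho$ be a permutation (possibly the empty permutation $\emptyset$). \begin{itemize} \item If $\rho=\emptyset$, $\rho=1$ or $\rho=12$, then $\mathbf{PSB}^{-1}(\mathrm{Av}(\rho))$ equals $\mathrm{Av}(\emptyset)$, $\mathrm{Av}(1)$ or $\mathrm{Av}(12,21)$, respectively. \item If $\rho=n\alpha$ for some $\alpha\in S_{n-1}$, $\alpha\neq\emptyset$, then $\mathbf{PSB}^{-1}(\mathrm{Av}(\rho))=\mathrm{Av}(B)$, where $$B=\{n(n+1)\alpha\}\cup\{(n+2)\,n\,\tau : \tau\in (n+1)\sqcup\!\sqcup\,\alpha,\ \tau\neq (n+1)\alpha\}.$$ \item If $\rho=(n-1)\alpha n$ for some $\alpha\in S_{n-2}$, $\alpha\neq\emptyset$, then $\mathbf{PSB}^{-1}(\mathrm{Av}(\rho))=\mathrm{Av}(B)$, where $$B=\{(n-1)n\alpha\}\cup\{(n+1)(n-1)\tau : \tau\in n\sqcup\!\sqcup\,\alpha,\ \tau\neq n\alpha\}.$$ \item In all the remaining cases, $\mathbf{PSB}^{-1}(\mathrm{Av}(\rho))$ is not a permutation class. \end{itemize}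
   Context: $S_n$ is the set of permutations of $\{1,\dots,n\}$ in one-line notation; juxtaposition denotes concatenation of sequences. $\mathrm{Av}(T)$ is the set of permutations, of all sizes, avoiding (in the classical sense) every pattern in $T$; every permutation contains the empty permutation $\emptyset$. A permutation class is a set $C$ of permutations such that every pattern contained in a permutation of $C$ is also in $C$. For sequences $\rho,\sigma$ of distinct integers, $\rho\sqcup\!\sqcup\,\sigma$ is the set of all shuffles of $\rho$ and $\sigma$, i.e. sequences containing both $\rho$ and $\sigma$ as subsequences and containing no elements other than those of $\rho$ and $\sigma$ (for example $(n+1)\sqcup\!\sqcup\,\alpha$ is the set of sequences obtained by inserting $n+1$ in some position of $\alpha$). For a set $A$ of permutations, $\mathbf{PSB}^{-1}(A)$ is the set of permutations $\pi$ with $\mathbf{PSB}(\pi)\in A$. The map $\mathbf{PSB}$: given an input permutation $\pi=\pi_1\cdots\pi_n$, a pop stack $S$ (initially empty) is used. For $i=1,\dots,n$ in order: (1) if $S$ is empty or $\pi_i=\mathrm{TOP}(S)-1$, where $\mathrm{TOP}(S)$ is the current top element of $S$, push $\pi_i$ on top of $S$; (2) else if $\pi_i<\mathrm{TOP}(S)-1$, bypass: append $\pi_i$ directly to the right end of the output; (3) else pop, i.e. remove all elements of $S$, appending them to the output from top to bottom, and then push $\pi_i$ into $S$. After the last entry has been processed, pop $S$ once more. The resulting output is the permutation $\mathbf{PSB}(\pi)$ (and $\mathbf{PSB}(\emptyset)=\emptyset$). *)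

theory Defs
  imports "HOL-Library.Sublist" "HOL-Combinatorics.Multiset_Permutations"
begin

definition perms :: "nat list set" where
  "perms = (\<Union>n. permutations_of_set {1..n})"

definition order_isomorphic :: "nat list \<Rightarrow> nat list \<Rightarrow> bool" where
  "order_isomorphic xs ys \<longleftrightarrow>
     length xs = length ys \<and>
     (\<forall>i < length xs. \<forall>j < length xs. xs ! i < xs ! j \<longleftrightarrow> ys ! i < ys ! j)"

definition contains_pattern :: "nat list \<Rightarrow> nat list \<Rightarrow> bool" where
  "contains_pattern \<pi> \<tau> \<longleftrightarrow> (\<exists>xs. subseq xs \<pi> \<and> order_isomorphic xs \<tau>)"

definition Av :: "nat list set \<Rightarrow> nat list set" where
  "Av T = {\<pi> \<in> perms. \<forall>\<tau> \<in> T. \<not> contains_pattern \<pi> \<tau>}"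

definition permutation_class :: "nat list set \<Rightarrow> bool" where
  "permutation_class C \<longleftrightarrow>
     C \<subseteq> perms \<and>
     (\<forall>\<pi> \<in> C. \<forall>\<tau> \<in> perms. contains_pattern \<pi> \<tau> \<longrightarrow> \<tau> \<in> C)"

text \<open>
  A state is a pair of the pop stack, listed from top to bottom, and the output produced so far.
  The conditions comparing the entry \<open>x\<close> with \<open>TOP(S) - 1\<close> are
  written with the successor of \<open>x\<close>, which avoids truncated subtraction.
\<close>

fun psb_step :: "nat list \<times> nat list \<Rightarrow> nat \<Rightarrow> nat list \<times> nat list" where
  "psb_step ([], out) x = ([x], out)"
| "psb_step (t # s, out) x =
     (if Suc x = t then (x # t # s, out)
      else if Suc x < t then (t # s, out @ [x])
      else ([x], out @ t # s))"

definition PSB :: "nat list \<Rightarrow> nat list" where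
  "PSB \<pi> = (case foldl psb_step ([], []) \<pi> of (s, out) \<Rightarrow> out @ s)"

definition PSB_preimage :: "nat list set \<Rightarrow> nat list set" where
  "PSB_preimage A = {\<pi> \<in> perms. PSB \<pi> \<in> A}"

end

theory Submission
  imports Defs
begin

text \<open>
  The bottom of the pop stack is always the maximum read so far, and the stack is an interval of
  values. Once an entry c has been output, all smaller entries bypass the stack, so they follow c in
  the output in their input order; and c is output either at once, when it bypasses the stack, or on
  the arrival of the next larger entry. Hence c followed by smaller entries survives in the output
  exactly when the input has a larger entry between c and them, or one before c together with
  an intermediate value that arrives too late to join the stack before c. Since the output ends
  with its maximum, appending a new maximum to a pattern not ending in its maximum changes nothing.
  In the remaining cases, inserting a new maximum into a suitable preimage of the pattern forces an
  early pop that exchanges two entries of the output.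
\<close>

section \<open>Permutations and order isomorphism\<close>

lemma perms_iff: "\<pi> \<in> perms \<longleftrightarrow> (\<exists>n. set \<pi> = {1..n} \<and> distinct \<pi>)"
  by (auto simp: perms_def permutations_of_set_def)

lemma perms_set_eq: "\<pi> \<in> perms \<Longrightarrow> set \<pi> = {1..length \<pi>}"
proof -
  assume "\<pi> \<in> perms"
  then obtain n where n: "set \<pi> = {1..n}" "distinct \<pi>" unfolding perms_iff by blast
  have "length \<pi> = n" using distinct_card[OF n(2)] unfolding n(1) by simp
  then show "set \<pi> = {1..length \<pi>}" using n(1) by simp
qed

lemma order_isomorphic_zip:
  "order_isomorphic xs ys \<longleftrightarrow> length xs = length ys \<and>
     (\<forall>(a, b) \<in> set (zip xs ys). \<forall>(c, d) \<in> set (zip xs ys). a < c \<longleftrightarrow> b < d)"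
  unfolding order_isomorphic_def by (auto simp: set_zip; metis)

lemma order_isomorphic_length: "order_isomorphic xs ys \<Longrightarrow> length xs = length ys"
  by (simp add: order_isomorphic_def)

lemma order_isomorphic_refl: "order_isomorphic xs xs"
  by (simp add: order_isomorphic_def)

text \<open>Since \<open>y\<close> tops the right-hand word, every comparison with the inserted pair
  is settled by whether \<open>x\<close> tops the left-hand word; the length hypothesis aligns the
  two insertions. All patterns below are decomposed by peeling off maxima in this way.\<close>

lemma order_isomorphic_insert_max:
  assumes "length as = length cs" and "\<forall>z \<in> set (cs @ ds). z < y"
  shows "order_isomorphic (as @ x # bs) (cs @ y # ds) \<longleftrightarrow>
    order_isomorphic (as @ bs) (cs @ ds) \<and> (\<forall>z \<in> set (as @ bs). z < x)"
proof (cases "length bs = length ds")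
  case True
  have fst_set: "set (as @ bs) = fst ` set (zip (as @ bs) (cs @ ds))"
    using True assms(1) by (metis length_append list.set_map map_fst_zip)
  have snd_lt: "\<forall>p \<in> set (zip (as @ bs) (cs @ ds)). snd p < y"
    using assms(2) by (auto dest: set_zip_rightD)
  define Z where "Z = set (zip (as @ bs) (cs @ ds))"
  have "set (zip (as @ x # bs) (cs @ y # ds)) = insert (x, y) Z"
    using assms(1) True by (auto simp: Z_def)
  then have "order_isomorphic (as @ x # bs) (cs @ y # ds) \<longleftrightarrow>
      (\<forall>p \<in> insert (x, y) Z. \<forall>q \<in> insert (x, y) Z. fst p < fst q \<longleftrightarrow> snd p < snd q)"
    using True assms(1) by (simp only: order_isomorphic_zip case_prod_unfold) simp
  also have "\<dots> \<longleftrightarrow> (\<forall>p \<in> Z. \<forall>q \<in> Z. fst p < fst q \<longleftrightarrow> snd p < snd q) \<and> (\<forall>p \<in> Z. fst p < x)"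
    using snd_lt unfolding Z_def[symmetric] by (simp add: ball_conj_distrib) (meson less_asym)
  also have "\<dots> \<longleftrightarrow> order_isomorphic (as @ bs) (cs @ ds) \<and> (\<forall>z \<in> set (as @ bs). z < x)"
    using True assms(1) unfolding fst_set Z_def[symmetric] order_isomorphic_zip case_prod_unfold by simp
  finally show ?thesis .
next
  case False
  then show ?thesis using assms(1) by (simp add: order_isomorphic_def)
qed

lemma order_isomorphic_split:
  assumes "order_isomorphic xs (cs @ y # ds)"
  obtains as x bs where "xs = as @ x # bs" "length as = length cs"
proof -
  have "length cs < length xs"
    using assms by (simp add: order_isomorphic_def)
  then show thesis
    using that[of "take (length cs) xs" "xs ! length cs" "drop (Suc (length cs)) xs"]
    by (simp add: id_take_nth_drop[symmetric])
qed

lemma order_isomorphic_snoc_max: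
  assumes "\<forall>z \<in> set cs. z < y"
  shows "order_isomorphic xs (cs @ [y]) \<longleftrightarrow>
    (\<exists>as x. xs = as @ [x] \<and> order_isomorphic as cs \<and> (\<forall>z \<in> set as. z < x))" (is "?L \<longleftrightarrow> ?R")
proof
  assume L: ?L
  then obtain as x bs where xs: "xs = as @ x # bs" "length as = length cs"
    by (rule order_isomorphic_split)
  then have "bs = []" using order_isomorphic_length[OF L] by simp
  then show ?R using L xs assms order_isomorphic_insert_max[of as cs "[]" y x "[]"] by auto
next
  assume ?R
  then obtain as x where "xs = as @ [x]" "order_isomorphic as cs" "\<forall>z \<in> set as. z < x"
    by blast
  then show ?L using assms order_isomorphic_insert_max[of as cs "[]" y x "[]"]
    by (simp add: order_isomorphic_length)
qed

lemma order_isomorphic_Cons_max: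
  assumes "\<forall>z \<in> set cs. z < y"
  shows "order_isomorphic xs (y # cs) \<longleftrightarrow>
    (\<exists>as x. xs = x # as \<and> order_isomorphic as cs \<and> (\<forall>z \<in> set as. z < x))" (is "?L \<longleftrightarrow> ?R")
proof
  assume L: ?L
  then obtain as x where "xs = x # as"
    by (cases xs) (auto simp: order_isomorphic_def)
  then show ?R using L assms order_isomorphic_insert_max[of "[]" "[]" cs y x as] by auto
next
  assume ?R
  then obtain as x where "xs = x # as" "order_isomorphic as cs" "\<forall>z \<in> set as. z < x"
    by blast
  then show ?L using assms order_isomorphic_insert_max[of "[]" "[]" cs y x as] by simp
qed

text \<open>An order isomorphism transfers \<open>last < x\<close> and hence its negation. Ending in
  the maximum is thus an invariant, which later excludes candidate occurrences.\<close>

lemma order_isomorphic_last_max: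
  assumes "order_isomorphic xs ys" and "xs \<noteq> []"
  shows "(\<forall>x \<in> set xs. x \<le> last xs) \<longleftrightarrow> (\<forall>y \<in> set ys. y \<le> last ys)"
proof -
  have len: "length ys = length xs" and ne: "ys \<noteq> []"
    using assms by (auto simp: order_isomorphic_def)
  have iso: "xs ! i < xs ! j \<longleftrightarrow> ys ! i < ys ! j" if "i < length xs" "j < length xs" for i j
    using assms that by (simp add: order_isomorphic_def)
  have "xs ! i \<le> last xs \<longleftrightarrow> ys ! i \<le> last ys" if "i < length xs" for i
    using iso[of "length xs - 1" i] that len assms(2) ne by (simp add: last_conv_nth flip: not_less)
  then show ?thesis
    by (simp add: all_set_conv_all_nth len)
qed

text \<open>Removing the maximum of \<open>ys\<close> and its partner in \<open>xs\<close> shortens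
  both words, and the equal entry sets force the two removed entries to agree.\<close>

lemma order_isomorphic_perm_eq:
  assumes "order_isomorphic xs ys" "distinct xs" "distinct ys" "set xs = set ys"
  shows "xs = ys"
  using assms
proof (induction "length xs" arbitrary: xs ys)
  case 0
  then show ?case by (simp add: order_isomorphic_def)
next
  case (Suc k)
  define y where "y = Max (set ys)"
  have ne: "set ys \<noteq> {}" using Suc.hyps(2) Suc.prems(4) by force
  then obtain cs ds where ys: "ys = cs @ y # ds"
    unfolding y_def by (meson List.finite_set Max_in split_list)
  have ymax: "z < y" if "z \<in> set (cs @ ds)" for z
  proof -
    have "z \<le> y" unfolding y_def by (rule Max_ge) (use that ys in auto)
    moreover have "z \<noteq> y" using that Suc.prems(3) ys by auto
    ultimately show ?thesis by simp
  qed
  obtain as x bs where xs: "xs = as @ x # bs" "length as = length cs"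
    using Suc.prems(1) unfolding ys by (rule order_isomorphic_split)
  have iso: "order_isomorphic (as @ bs) (cs @ ds)" and xmax: "\<forall>z \<in> set (as @ bs). z < x"
    using Suc.prems(1) order_isomorphic_insert_max[of as cs ds y x bs] xs ys ymax by auto
  have "x = y"
  proof (rule ccontr)
    assume "x \<noteq> y"
    \<comment> \<open>Each of \<open>x\<close> and \<open>y\<close> would lie among the entries
      dominated by the other, giving \<open>x < y\<close> and \<open>y < x\<close>.\<close>
    then have "x \<in> set (cs @ ds)" "y \<in> set (as @ bs)" using Suc.prems(4) xs ys by auto
    then show False using xmax ymax less_asym by blast
  qed
  moreover have "as @ bs = cs @ ds"
  proof (rule Suc.hyps(1)[OF _ iso])
    have "set (as @ bs) = set xs - {x}" using Suc.prems(2) xs by auto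
    also have "\<dots> = set (cs @ ds)" using Suc.prems(3,4) ys \<open>x = y\<close> by auto
    finally show "set (as @ bs) = set (cs @ ds)" .
  qed (use Suc.hyps(2) Suc.prems xs ys in auto)
  ultimately show ?case using xs ys by simp
qed

section \<open>The stack and the output during a run\<close>

abbreviation psb_run :: "nat list \<Rightarrow> nat list \<times> nat list" where
  "psb_run \<equiv> foldl psb_step ([], [])"

lemma mset_psb_step:
  "mset (fst (psb_step (s, out) x)) + mset (snd (psb_step (s, out) x)) = mset s + mset out + {#x#}"
  by (cases s) auto

lemma mset_psb_run: "mset (fst (psb_run p)) + mset (snd (psb_run p)) = mset p"
proof (induction p rule: rev_induct)
  case (snoc x p)
  then show ?case
    using mset_psb_step[of "fst (psb_run p)" "snd (psb_run p)" x] by simp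
qed simp

lemma set_psb_run: "psb_run p = (s, out) \<Longrightarrow> set s \<union> set out = set p"
  using arg_cong[OF mset_psb_run[of p], of set_mset] by simp

lemma psb_run_stack_subset: "psb_run p = ([t..<Suc m], out) \<Longrightarrow> {t..m} \<subseteq> set p"
  using set_psb_run[of p "[t..<Suc m]" out]
  by (metis Un_upper1 atLeastLessThanSuc_atLeastAtMost set_upt)

lemma mset_PSB: "mset (PSB \<pi>) = mset \<pi>"
  using mset_psb_run[of \<pi>] by (auto simp: PSB_def add.commute split: prod.split)

lemma set_PSB: "set (PSB \<pi>) = set \<pi>"
  using mset_PSB mset_eq_setD by blast

lemma distinct_PSB: "distinct (PSB \<pi>) = distinct \<pi>"
  using mset_PSB mset_eq_imp_distinct_iff by blast

lemma length_PSB: "length (PSB \<pi>) = length \<pi>"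
  using mset_PSB mset_eq_length by blast

lemma PSB_perms: "\<pi> \<in> perms \<Longrightarrow> PSB \<pi> \<in> perms"
  by (simp add: perms_iff set_PSB distinct_PSB)

text \<open>The stack remains an interval reaching up to the largest entry read: a push extends it
  downwards by one, a bypass leaves it alone, and a pop restarts it at a new maximum.\<close>

lemma psb_run_state:
  assumes "distinct p" "p \<noteq> []"
  obtains t m out where "psb_run p = ([t..<Suc m], out)" "t \<le> m" "set p \<subseteq> {..m}"
proof -
  have "\<exists>t m out. psb_run p = ([t..<Suc m], out) \<and> t \<le> m \<and> set p \<subseteq> {..m}"
    using assms
  proof (induction p rule: rev_induct)
    case (snoc x p)
    show ?case
    proof (cases "p = []")
      case False
      then obtain t m out where IH: "psb_run p = ([t..<Suc m], out)" "t \<le> m" "set p \<subseteq> {..m}"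
        using snoc by auto
      \<comment> \<open>Values in the interval have already been read, so by distinctness the last
        branch of \<open>psb_step\<close> occurs only for a new maximum
        \<open>m < x\<close>.\<close>
      have "x \<notin> {t..m}" using psb_run_stack_subset[OF IH(1)] snoc.prems(1) by auto
      then consider "Suc x = t" | "Suc x < t" | "m < x" by fastforce
      then show ?thesis
      proof cases
        case 1
        then show ?thesis using IH
          by (intro exI[of _ x] exI[of _ m] exI[of _ out]) (auto simp: upt_conv_Cons simp del: upt_Suc)
      next
        case 2
        then show ?thesis using IH
          by (intro exI[of _ t] exI[of _ m] exI[of _ "out @ [x]"])
            (auto simp: upt_conv_Cons simp del: upt_Suc)
      next
        case 3
        then show ?thesis using IH
          by (intro exI[of _ x] exI[of _ x] exI[of _ "out @ [t..<Suc m]"])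
            (auto simp: upt_conv_Cons simp del: upt_Suc)
      qed
    next
      case True
      then show ?thesis by (intro exI[of _ x] exI[of _ "[]"]) simp
    qed
  qed simp
  then show thesis using that by blast
qed

text \<open>The final pop lists the stack interval upwards, so it ends with the largest entry
  read.\<close>

lemma PSB_ends_with_max:
  assumes "\<pi> \<in> perms" "\<pi> \<noteq> []"
  obtains \<sigma> where "PSB \<pi> = \<sigma> @ [length \<pi>]" "\<forall>x \<in> set \<sigma>. x < length \<pi>"
proof -
  have d: "distinct \<pi>" using assms(1) by (auto simp: perms_iff)
  obtain t m out where st: "psb_run \<pi> = ([t..<Suc m], out)" "t \<le> m" "set \<pi> \<subseteq> {..m}"
    using psb_run_state[OF d assms(2)] .
  \<comment> \<open>Both \<open>m\<close> and \<open>length \<pi>\<close> are entries and bound all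
    entries, so they coincide.\<close>
  have "m \<in> set \<pi>" using psb_run_stack_subset[OF st(1)] st(2) by auto
  moreover have "length \<pi> \<in> set \<pi>" using perms_set_eq[OF assms(1)] assms(2) by (simp add: Suc_leI)
  ultimately have "m = length \<pi>" using st(3) perms_set_eq[OF assms(1)] by (simp add: le_antisym subset_eq)
  have P: "PSB \<pi> = (out @ [t..<m]) @ [m]" using st by (simp add: PSB_def)
  have "\<forall>x \<in> set (out @ [t..<m]). x < m"
  proof
    fix x assume x: "x \<in> set (out @ [t..<m])"
    then have "x \<in> set (PSB \<pi>)" unfolding P by simp
    then have "x \<in> set \<pi>" unfolding set_PSB .
    moreover have "distinct ((out @ [t..<m]) @ [m])" using d distinct_PSB[of \<pi>] unfolding P by simp
    then have "x \<noteq> m" using x by auto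
    ultimately show "x < m" using st(3) by force
  qed
  then show thesis using that P \<open>m = length \<pi>\<close> by simp
qed

section \<open>How a single entry reaches the output\<close>

text \<open>Entries read after the top was placed all bypass it, so their successors lie below
  \<open>Suc x\<close> and none of them can be \<open>x\<close>.\<close>

lemma psb_run_pred_before_top:
  assumes "psb_run p = (s, out)" "s \<noteq> []" "x \<in> set p" "Suc x = hd s"
  shows "subseq [x, Suc x] p"
  using assms
proof (induction p arbitrary: s out rule: rev_induct)
  case (snoc z p)
  obtain s' out' where r: "psb_run p = (s', out')" by fastforce
  show ?case
  proof (cases "s' \<noteq> [] \<and> Suc z < hd s'")
    case True
    then have "s = s'" using snoc.prems(1) r by (cases s') auto
    then have "subseq [x, Suc x] p" using snoc.IH[OF r] snoc.prems True by auto
    then show ?thesis by (rule subseq_rev_drop_many)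
  next
    case False
    then have "z = Suc x" using snoc.prems r by (cases s') (auto split: if_splits)
    then have "subseq ([x] @ [Suc x]) (p @ [z])"
      using snoc.prems(3) by (intro list_emb_append_mono) (auto simp: subseq_singleton_left)
    then show ?thesis by simp
  qed
qed simp

text \<open>An entry below \<open>c\<close> satisfies \<open>Suc x \<le> c < t\<close> for the top
  \<open>t\<close> and so bypasses, while pushes and pops involve only entries above
  \<open>c\<close>. Filtering by \<open>x < c\<close> records that the small entries leave in input
  order.\<close>

lemma psb_fold_above:
  assumes "s \<noteq> []" "\<forall>y \<in> set s. c < y" "c \<notin> set q"
  obtains s' r where "foldl psb_step (s, out) q = (s', out @ r)" "\<forall>y \<in> set s'. c < y"
    "filter (\<lambda>x. x < c) r = filter (\<lambda>x. x < c) q"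
proof -
  have "\<exists>s' r. foldl psb_step (s, out) q = (s', out @ r) \<and> (\<forall>y \<in> set s'. c < y) \<and>
    filter (\<lambda>x. x < c) r = filter (\<lambda>x. x < c) q"
    using assms
  proof (induction q arbitrary: s out)
    case (Cons x q)
    obtain t s0 where s: "s = t # s0" using Cons.prems(1) by (cases s) auto
    consider "Suc x = t" | "Suc x < t" | "t \<le> x" by linarith
    then show ?case
    proof cases
      case 1
      \<comment> \<open>The bound \<open>c < t = Suc x\<close> still allows \<open>x = c\<close>,
        which \<open>c \<notin> set q\<close> of the premises excludes.\<close>
      then have "c < x" using Cons.prems s by auto
      then show ?thesis using Cons.IH[of "x # s" out] Cons.prems s 1 by auto
    next
      case 2
      obtain s' r where "foldl psb_step (s, out @ [x]) q = (s', (out @ [x]) @ r)"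
        "\<forall>y \<in> set s'. c < y" "filter (\<lambda>x. x < c) r = filter (\<lambda>x. x < c) q"
        using Cons.IH[of s "out @ [x]"] Cons.prems by auto
      then show ?thesis using s 2 by (intro exI[of _ s'] exI[of _ "x # r"]) auto
    next
      case 3
      then have "c < x" using Cons.prems s by auto
      obtain s' r where "foldl psb_step ([x], out @ s) q = (s', (out @ s) @ r)"
        "\<forall>y \<in> set s'. c < y" "filter (\<lambda>x. x < c) r = filter (\<lambda>x. x < c) q"
        using Cons.IH[of "[x]" "out @ s"] Cons.prems \<open>c < x\<close> by auto
      \<comment> \<open>The popped stack lies above \<open>c\<close> and vanishes under the
        filter.\<close>
      moreover have "filter (\<lambda>x. x < c) s = []" using Cons.prems(2) by (auto simp: filter_empty_conv)
      moreover have "psb_step (s, out) x = ([x], out @ s)" using s 3 by simp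
      ultimately show ?thesis using \<open>c < x\<close>
        by (intro exI[of _ s'] exI[of _ "s @ r"]) simp
    qed
  qed auto
  then show thesis using that by blast
qed

text \<open>An incoming entry avoids \<open>{t..m}\<close> and lies below \<open>c\<close>, hence
  below \<open>t\<close>. It either lowers the left end of the interval by one or bypasses, so
  \<open>c\<close> is never popped.\<close>

lemma psb_fold_below:
  assumes "t \<le> c" "c \<le> m" "\<forall>x \<in> set q. x < c" "distinct q" "set q \<inter> {t..m} = {}"
  obtains t' r where "foldl psb_step ([t..<Suc m], out) q = ([t'..<Suc m], r)" "t' \<le> c"
proof -
  have "\<exists>t' r. foldl psb_step ([t..<Suc m], out) q = ([t'..<Suc m], r) \<and> t' \<le> c"
    using assms
  proof (induction q arbitrary: t out)
    case (Cons x q)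
    have "x \<notin> {t..m}" "x < c" using Cons.prems by auto
    then have "x < t" using Cons.prems(2) by auto
    show ?case
    proof (cases "Suc x = t")
      case True
      have "set q \<inter> {x..m} = {}" 
      proof -
        have "{x..m} = insert x {t..m}" using \<open>x < c\<close> Cons.prems(2) True by auto
        then show ?thesis using Cons.prems(4,5) by auto
      qed
      then show ?thesis using Cons.IH[of x out] Cons.prems True
        by (auto simp: upt_conv_Cons simp del: upt_Suc)
    next
      case False
      then show ?thesis using Cons.IH[of t "out @ [x]"] Cons.prems \<open>x < t\<close>
        by (auto simp: upt_conv_Cons simp del: upt_Suc)
    qed
  qed (auto simp del: upt_Suc)
  then show thesis using that by blast
qed

text \<open>Here \<open>c\<close> goes straight to the output under a stack above it, so every
  smaller entry read afterwards bypasses too, and the final pop contributes nothing below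
  \<open>c\<close>.\<close>

lemma PSB_bypassed:
  assumes "distinct (p @ c # q)" "psb_run p = (s, out)" "s \<noteq> []" "Suc c < hd s"
  obtains u v where "PSB (p @ c # q) = u @ c # v" "filter (\<lambda>x. x < c) v = filter (\<lambda>x. x < c) q"
proof -
  have "distinct p" "p \<noteq> []" using assms(1-3) by auto
  then obtain t m out' where st: "psb_run p = ([t..<Suc m], out')" "t \<le> m"
    using psb_run_state by metis
  have s: "s = [t..<Suc m]" using st assms(2) by simp
  then have "Suc c < t" using st(2) assms(4) by (simp add: hd_upt del: upt_Suc)
  then have above: "\<forall>y \<in> set s. c < y" using s by auto
  have "c \<notin> set q" using assms(1) by auto
  with assms(3) above
  obtain s' r where f: "foldl psb_step (s, out @ [c]) q = (s', (out @ [c]) @ r)"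
    "\<forall>y \<in> set s'. c < y" "filter (\<lambda>x. x < c) r = filter (\<lambda>x. x < c) q"
    by (rule psb_fold_above)
  have "psb_step (s, out) c = (s, out @ [c])" using assms(3,4) by (cases s) auto
  then have "PSB (p @ c # q) = out @ c # (r @ s')" using f(1) assms(2) by (simp add: PSB_def)
  moreover have "filter (\<lambda>x. x < c) s' = []" using f(2) by (auto simp: filter_empty_conv)
  ultimately show thesis using that f(3) by simp
qed

text \<open>Without a bypass \<open>c\<close> becomes the top, whether by a push or after a pop, and
  the smaller entries of \<open>d\<close> cannot trigger a pop.\<close>

lemma psb_run_entered:
  assumes "distinct (p @ c # d)" "\<forall>x \<in> set d. x < c" "psb_run p = (s, out)"
    "\<not> (s \<noteq> [] \<and> Suc c < hd s)"
  obtains t m r where "psb_run (p @ c # d) = ([t..<Suc m], r)" "t \<le> c" "c \<le> m"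
proof -
  have "distinct (p @ [c])" "p @ [c] \<noteq> []" using assms(1) by auto
  then obtain t m out' where st: "psb_run (p @ [c]) = ([t..<Suc m], out')" "t \<le> m"
    using psb_run_state by metis
  have "hd (fst (psb_step (s, out) c)) = c"
    using assms(4) by (cases s) auto
  then have "t = c" using st assms(3) by (simp add: hd_upt del: upt_Suc)
  have "{c..m} \<subseteq> set (p @ [c])" using psb_run_stack_subset[OF st(1)] \<open>t = c\<close> by simp
  then have "set d \<inter> {c..m} = {}" using assms(1) by auto
  then obtain t' r where "foldl psb_step ([t..<Suc m], out') d = ([t'..<Suc m], r)" "t' \<le> c"
    using psb_fold_below[of c c m d out'] assms(1,2) st(2) \<open>t = c\<close> by auto
  then show thesis using that st \<open>t = c\<close> by (simp del: upt_Suc)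
qed

lemma upt_split_at: "t \<le> c \<Longrightarrow> c \<le> m \<Longrightarrow> [t..<Suc m] = [t..<c] @ c # [Suc c..<Suc m]"
  using upt_add_eq_append[of t c "Suc m - c"] by (simp add: upt_conv_Cons del: upt_Suc)

text \<open>The first larger entry \<open>y\<close> flushes the stack. The entries of
  \<open>d\<close> have by then bypassed or sit above \<open>c\<close> on the stack, so they precede
  \<open>c\<close> in the output; the values below \<open>c\<close> that follow it are those of
  \<open>q\<close>.\<close>

lemma PSB_entered_popped:
  assumes "distinct (p @ c # d @ y # q)" "\<forall>x \<in> set d. x < c" "c < y" "psb_run p = (s, out)"
    "\<not> (s \<noteq> [] \<and> Suc c < hd s)"
  obtains u v where "PSB (p @ c # d @ y # q) = u @ c # v"
    "filter (\<lambda>x. x < c) v = filter (\<lambda>x. x < c) q"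
proof -
  have "distinct (p @ c # d)" using assms(1) by auto
  then obtain t m r where st: "psb_run (p @ c # d) = ([t..<Suc m], r)" "t \<le> c" "c \<le> m"
    using psb_run_entered assms by metis
  have pop: "psb_step ([t..<Suc m], r) y = ([y], r @ [t..<Suc m])"
    using st assms(3) by (simp add: upt_conv_Cons del: upt_Suc)
  have "[y] \<noteq> []" "\<forall>z \<in> set [y]. c < z" "c \<notin> set q" using assms(1,3) by auto
  then obtain s' r' where f: "foldl psb_step ([y], r @ [t..<Suc m]) q = (s', (r @ [t..<Suc m]) @ r')"
    "\<forall>y \<in> set s'. c < y" "filter (\<lambda>x. x < c) r' = filter (\<lambda>x. x < c) q"
    by (rule psb_fold_above)
  have "psb_run (p @ c # d @ y # q) = foldl psb_step (psb_step (psb_run (p @ c # d)) y) q"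
    by simp
  also have "\<dots> = (s', (r @ [t..<Suc m]) @ r')" using st pop f by (simp del: upt_Suc)
  \<comment> \<open>The stack pops in increasing order, so cutting its interval at \<open>c\<close>
    separates what leaves before \<open>c\<close> from what leaves after it.\<close>
  finally have P: "PSB (p @ c # d @ y # q) = (r @ [t..<c]) @ c # ([Suc c..<Suc m] @ r' @ s')"
    using upt_split_at[OF st(2,3)] by (simp add: PSB_def del: upt_Suc)
  have "filter (\<lambda>x. x < c) s' = []" "filter (\<lambda>x. x < c) [Suc c..<Suc m] = []"
    using f(2) by (auto simp: filter_empty_conv simp del: upt_Suc)
  then show thesis using f(3) by (intro that[OF P]) (simp del: upt_Suc)
qed

text \<open>With no larger entry after it, \<open>c\<close> leaves only in the final pop, followed
  by larger values alone.\<close>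

lemma PSB_entered_kept:
  assumes "distinct (p @ c # d)" "\<forall>x \<in> set d. x < c" "psb_run p = (s, out)"
    "\<not> (s \<noteq> [] \<and> Suc c < hd s)"
  obtains u v where "PSB (p @ c # d) = u @ c # v" "filter (\<lambda>x. x < c) v = []"
proof -
  have "distinct (p @ c # d)" using assms(1) by auto
  then obtain t m r where st: "psb_run (p @ c # d) = ([t..<Suc m], r)" "t \<le> c" "c \<le> m"
    using psb_run_entered assms by metis
  then have "PSB (p @ c # d) = (r @ [t..<c]) @ c # [Suc c..<Suc m]"
    using upt_split_at[OF st(2,3)] by (simp add: PSB_def del: upt_Suc)
  moreover have "filter (\<lambda>x. x < c) [Suc c..<Suc m] = []"
    by (auto simp: filter_empty_conv simp del: upt_Suc)
  ultimately show thesis using that by blast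
qed

section \<open>Occurrences in the output traced to the input\<close>

lemma subseq_Cons_split:
  assumes "subseq (x # xs) ys"
  obtains us vs where "ys = us @ x # vs" "subseq xs vs"
  using list_emb_ConsD[OF assms] by auto

lemma subseq_snocD: "subseq (xs @ [x]) ys \<Longrightarrow> subseq xs ys"
  using subseq_order.trans[OF subseq_rev_drop_many[OF subseq_order.refl]] by blast

lemma subseq_filter_iff:
  "\<forall>x \<in> set xs. P x \<Longrightarrow> subseq xs (filter P ys) \<longleftrightarrow> subseq xs ys"
  by (metis filter_True subseq_filter subseq_filter_left subseq_order.order_trans)

lemma subseq_Cons_append_notin:
  "x \<notin> set us \<Longrightarrow> subseq (x # xs) (us @ ys) \<longleftrightarrow> subseq (x # xs) ys"
  by (induction us) auto

lemma subseq_Cons_distinct_iff: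
  "distinct (us @ x # vs) \<Longrightarrow> subseq (x # xs) (us @ x # vs) \<longleftrightarrow> subseq xs vs"
  by (simp add: subseq_Cons_append_notin)

text \<open>If \<open>c\<close> enters the stack, the first larger entry after it must precede
  \<open>as\<close>, which gives the first outcome with \<open>c' = c\<close>. If \<open>c\<close>
  bypasses a top \<open>t\<close>, the value \<open>t - 1\<close> decides: read before
  \<open>c\<close>, it replaces \<open>c\<close> and \<open>t\<close> serves as \<open>M\<close>;
  read after \<open>c\<close>, it falls before \<open>as\<close> or cuts \<open>as\<close> into a
  nonempty \<open>bs\<close> and \<open>ds\<close>.\<close>

lemma PSB_subseqD:
  assumes "\<pi> \<in> perms" "as \<noteq> []" "\<forall>a \<in> set as. a < c" "subseq (c # as) (PSB \<pi>)"
  obtains (popped) c' M where "c \<le> c'" "c' < M" "subseq (c' # M # as) \<pi>"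
  | (bypassed) M x bs ds where "as = bs @ ds" "bs \<noteq> []" "c < x" "x < M"
      "subseq (M # c # bs @ x # ds) \<pi>"
proof -
  have dist: "distinct \<pi>" using assms(1) by (auto simp: perms_iff)
  have "c \<in> set \<pi>"
    using assms(4) set_PSB[of \<pi>] by (metis list.set_intros(1) notin_set_nthsI subseq_conv_nths)
  then obtain p q where \<pi>: "\<pi> = p @ c # q" by (auto dest: split_list)
  obtain s out where run: "psb_run p = (s, out)" by fastforce
  have keep: "subseq as r"
    \<comment> \<open>Distinctness fixes the position of \<open>c\<close> in the output, so any
      block \<open>r\<close> agreeing below \<open>c\<close> with what follows contains
      \<open>as\<close>. All cases use this transport.\<close>
    if "PSB \<pi> = u @ c # v" "filter (\<lambda>x. x < c) v = filter (\<lambda>x. x < c) r" for u v r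
    using assms(3,4) that subseq_Cons_distinct_iff[of u c v as] dist distinct_PSB[of \<pi>]
      subseq_filter_iff[of as "\<lambda>x. x < c"] by metis
  show thesis
  proof (cases "s \<noteq> [] \<and> Suc c < hd s")
    case True
    obtain u v where "PSB \<pi> = u @ c # v" "filter (\<lambda>x. x < c) v = filter (\<lambda>x. x < c) q"
      using PSB_bypassed dist run True unfolding \<pi> by metis
    then have as: "subseq as q" by (rule keep)
    have "distinct p" "p \<noteq> []" using run True dist \<pi> by auto
    then obtain t m out' where st: "psb_run p = ([t..<Suc m], out')" "t \<le> m"
      using psb_run_state by metis
    have s: "s = [t..<Suc m]" using st run by simp
    then have ct: "Suc c < t" using st(2) True by (simp add: hd_upt del: upt_Suc)
    define x where "x = t - 1"
    have x: "c < x" "x < t" "Suc x = t" using ct by (auto simp: x_def)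
    have tp: "t \<in> set p" using psb_run_stack_subset[OF st(1)] st(2) by auto
    \<comment> \<open>A permutation has no missing values, so the value \<open>x\<close> between
      \<open>c\<close> and \<open>t\<close> occurs.\<close>
    have "x \<in> set \<pi>" using perms_set_eq[OF assms(1)] tp \<pi> x \<open>c \<in> set \<pi>\<close>
      by (metis Un_iff atLeastAtMost_iff less_imp_le order_trans set_append)
    then consider "x \<in> set p" | "x \<in> set q" using \<pi> x by auto
    then show thesis
    proof cases
      case 1
      \<comment> \<open>The witnesses are \<open>x\<close> and \<open>t\<close>, both read before
        \<open>c\<close>; as \<open>c < x\<close>, the entry \<open>x\<close> still dominates
        \<open>as\<close>.\<close>
      have "subseq [x, t] p"
        using psb_run_pred_before_top[OF run _ 1] True x s st(2) by (simp add: hd_upt del: upt_Suc)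
      then have "subseq ([x, t] @ as) \<pi>"
        unfolding \<pi> using as by (intro list_emb_append_mono) auto
      then show thesis using popped[of x t] x by simp
    next
      case 2
      then obtain e f where q: "q = e @ x # f" by (auto dest: split_list)
      obtain bs ds where bd: "as = bs @ ds" "subseq bs e" "subseq ds (x # f)"
        using as unfolding q by (rule subseq_appendE)
      \<comment> \<open>Since \<open>x\<close> exceeds every entry of \<open>as\<close>, the part
        \<open>ds\<close> must embed strictly after it.\<close>
      have "x \<notin> set ds" using assms(3) bd(1) x(1) by (metis Un_iff less_asym set_append)
      then have ds: "subseq ds f" using bd(3) by (cases ds) (auto split: if_splits)
      have bxd: "subseq (bs @ x # ds) q"
        unfolding q using bd(2) ds by (intro list_emb_append_mono) auto
      show thesis
      proof (cases "bs = []")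
        case True
        have "subseq (c # x # as) \<pi>"
          unfolding \<pi> using bxd bd(1) True by (intro subseq_drop_many) simp
        then show thesis using popped[of c x] x by simp
      next
        case False
        have "subseq ([t] @ c # bs @ x # ds) \<pi>"
          unfolding \<pi> using bxd tp by (intro list_emb_append_mono) (auto simp: subseq_singleton_left)
        then show thesis using bypassed[of bs ds x t] bd(1) False x by simp
      qed
    qed
  next
    case False
    show thesis
    proof (cases "\<exists>y \<in> set q. c < y")
      case True
      then obtain d y r where q: "q = d @ y # r" "c < y" "\<forall>z \<in> set d. \<not> c < z"
        by (metis split_list_first_prop)
      have "\<forall>z \<in> set d. z < c" using q dist \<pi> by (auto simp: not_less le_less)
      then obtain u v where "PSB \<pi> = u @ c # v" "filter (\<lambda>x. x < c) v = filter (\<lambda>x. x < c) r"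
        using PSB_entered_popped[OF _ _ \<open>c < y\<close> run False] dist unfolding \<pi> q(1) by metis
      then have "subseq as r" by (rule keep)
      then have "subseq (c # y # as) \<pi>"
        unfolding \<pi> q by (simp add: list_emb_append2)
      then show thesis using popped[of c y] q by simp
    next
      case none: False
      have "\<forall>z \<in> set q. z < c" using none dist \<pi> by (auto simp: not_less le_less)
      then obtain u v where "PSB \<pi> = u @ c # v" "filter (\<lambda>x. x < c) v = filter (\<lambda>x. x < c) []"
        using PSB_entered_kept[OF _ _ run False] dist unfolding \<pi> by (metis filter.simps(1))
      then have "subseq as []" by (rule keep)
      then show thesis using assms(2) by simp
    qed
  qed
qed

lemma PSB_subseqI:
  assumes "PSB \<pi> = u @ c # v" "filter (\<lambda>x. x < c) v = filter (\<lambda>x. x < c) q" "subseq as q"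
    "\<forall>a \<in> set as. a < c"
  shows "subseq (c # as) (PSB \<pi>)"
proof -
  have "subseq as v" using assms(2-4) subseq_filter_iff[of as "\<lambda>x. x < c"] by metis
  then show ?thesis by (simp add: assms(1) list_emb_append2)
qed

text \<open>If \<open>c\<close> bypasses, every smaller later entry follows it in the output.
  Otherwise \<open>c\<close> leaves at the latest when \<open>M\<close> arrives, hence before
  \<open>as\<close>.\<close>

lemma PSB_subseqI_popped:
  assumes "distinct \<pi>" "\<forall>a \<in> set as. a < c" "c < M" "subseq (c # M # as) \<pi>"
  shows "subseq (c # as) (PSB \<pi>)"
proof -
  obtain p q where \<pi>: "\<pi> = p @ c # q" and Mas: "subseq (M # as) q"
    using assms(4) by (rule subseq_Cons_split)
  obtain s out where run: "psb_run p = (s, out)" by fastforce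
  show ?thesis
  proof (cases "s \<noteq> [] \<and> Suc c < hd s")
    case True
    then show ?thesis
      using PSB_bypassed[of p c q s out] PSB_subseqI[OF _ _ subseq_Cons'[OF Mas] assms(2)] run
        assms(1) \<pi> by metis
  next
    case False
    have "M \<in> set q" using Mas by (metis list.set_intros(1) notin_set_nthsI subseq_conv_nths)
    then obtain d y r where q: "q = d @ y # r" "c < y" "\<forall>z \<in> set d. \<not> c < z"
      using assms(3) by (metis split_list_first_prop)
    have d: "\<forall>z \<in> set d. z < c" using q assms(1) \<pi> by (auto simp: not_less le_less)
    \<comment> \<open>No entry of \<open>d\<close> exceeds \<open>c\<close>, so \<open>M\<close> is
      found from \<open>y\<close> onwards.\<close>
    have "subseq (M # as) (y # r)"
      using Mas q(3) assms(3) unfolding q(1) by (subst (asm) subseq_Cons_append_notin) auto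
    then have "subseq as r" by (auto split: if_splits dest: subseq_Cons')
    then show ?thesis
      using PSB_entered_popped[of p c d y r s out] PSB_subseqI[OF _ _ _ assms(2), of \<pi> _ _ r] run
        False d q assms(1) \<pi> by metis
  qed
qed

text \<open>When \<open>c\<close> is read, the late entry \<open>x\<close> is outside the stack
  interval although \<open>x < M \<le> m\<close>, so the top lies above \<open>x\<close>, and
  \<open>c < x\<close> has to bypass.\<close>

lemma PSB_subseqI_bypassed:
  assumes "distinct \<pi>" "\<forall>a \<in> set (bs @ ds). a < c" "c < x" "x < M"
    "subseq (M # c # bs @ x # ds) \<pi>"
  shows "subseq (c # bs @ ds) (PSB \<pi>)"
proof -
  obtain p0 q0 where \<pi>0: "\<pi> = p0 @ M # q0" and q0: "subseq (c # bs @ x # ds) q0"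
    using assms(5) by (rule subseq_Cons_split)
  obtain p1 q where q0': "q0 = p1 @ c # q" and bxd: "subseq (bs @ x # ds) q"
    using q0 by (rule subseq_Cons_split)
  define p where "p = p0 @ M # p1"
  have \<pi>: "\<pi> = p @ c # q" by (simp add: p_def \<pi>0 q0')
  have "distinct p" "p \<noteq> []" using assms(1) \<pi> by (auto simp: p_def)
  then obtain t m out where st: "psb_run p = ([t..<Suc m], out)" "t \<le> m" "set p \<subseteq> {..m}"
    by (rule psb_run_state)
  have "M \<le> m" using st(3) by (auto simp: p_def)
  have "x \<in> set q" using bxd by (metis in_set_conv_decomp notin_set_nthsI subseq_conv_nths)
  then have "x \<notin> {t..m}" using psb_run_stack_subset[OF st(1)] assms(1) \<pi> by auto
  then have "Suc c < t" using \<open>M \<le> m\<close> assms(3,4) by auto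
  moreover have "subseq (bs @ ds) q"
    using bxd subseq_order.trans[of "bs @ ds" "bs @ x # ds" q]
    by (simp add: subseq_append' list_emb_Cons)
  moreover have "[t..<Suc m] \<noteq> []" "hd [t..<Suc m] = t"
    using st(2) by (simp_all add: hd_upt del: upt_Suc)
  moreover obtain u v where "PSB \<pi> = u @ c # v" "filter (\<lambda>x. x < c) v = filter (\<lambda>x. x < c) q"
    using PSB_bypassed[of p c q "[t..<Suc m]" out] assms(1) \<pi> st(1) calculation by metis
  ultimately show ?thesis using PSB_subseqI assms(2) by blast
qed

section \<open>Translation into the basis patterns\<close>

text \<open>Collapsing \<open>cs\<close> to one letter gives the shape 231; peeling off
  \<open>n + 1\<close> and then \<open>n\<close> yields the order conditions.\<close>

lemma order_isomorphic_231_iff: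
  assumes "\<forall>z \<in> set cs. z < n"
  shows "order_isomorphic xs (n # (n + 1) # cs) \<longleftrightarrow>
    (\<exists>c M as. xs = c # M # as \<and> order_isomorphic as cs \<and> (\<forall>a \<in> set as. a < c) \<and> c < M)"
    (is "?L \<longleftrightarrow> ?R")
proof -
  have ins: "order_isomorphic (c # M # as) (n # (n + 1) # cs) \<longleftrightarrow>
      order_isomorphic as cs \<and> (\<forall>a \<in> set as. a < c) \<and> c < M" for c M as
  proof -
    have "order_isomorphic (c # M # as) (n # (n + 1) # cs) \<longleftrightarrow>
      order_isomorphic (c # as) (n # cs) \<and> (\<forall>z \<in> set (c # as). z < M)"
      using order_isomorphic_insert_max[of "[c]" "[n]" cs "n + 1" M as] assms by fastforce
    also have "order_isomorphic (c # as) (n # cs) \<longleftrightarrow> order_isomorphic as cs \<and> (\<forall>a \<in> set as. a < c)"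
      using order_isomorphic_Cons_max[OF assms] by auto
    finally show ?thesis by auto
  qed
  show ?thesis
  proof
    assume L: ?L
    then obtain c M as where "xs = c # M # as"
      by (metis length_Suc_conv order_isomorphic_length)
    then show ?R using L ins by auto
  qed (use ins in auto)
qed

text \<open>The three largest entries are peeled off in the order \<open>n + 2\<close>,
  \<open>n + 1\<close>, \<open>n\<close>; the equal lengths of \<open>bs\<close> and
  \<open>cs\<close> fix where \<open>x\<close> sits.\<close>

lemma order_isomorphic_4213_iff:
  assumes "\<forall>z \<in> set (cs @ es). z < n"
  shows "order_isomorphic xs ((n + 2) # n # cs @ (n + 1) # es) \<longleftrightarrow>
    (\<exists>M c bs x ds. xs = M # c # bs @ x # ds \<and> length bs = length cs \<and>
       order_isomorphic (bs @ ds) (cs @ es) \<and> (\<forall>a \<in> set (bs @ ds). a < c) \<and> c < x \<and> x < M)"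
    (is "?L \<longleftrightarrow> ?R")
proof -
  have lt1: "\<forall>z \<in> set ((n # cs) @ es). z < n + 1" using assms by (auto simp: less_SucI)
  have lt2: "\<forall>z \<in> set (n # cs @ (n + 1) # es). z < n + 2" using assms by (auto simp: less_SucI)
  have ins: "order_isomorphic (M # c # bs @ x # ds) ((n + 2) # n # cs @ (n + 1) # es) \<longleftrightarrow>
      order_isomorphic (bs @ ds) (cs @ es) \<and> (\<forall>a \<in> set (bs @ ds). a < c) \<and> c < x \<and> x < M"
    if len: "length bs = length cs" for M c bs x ds
  proof -
    have "order_isomorphic (M # c # bs @ x # ds) ((n + 2) # n # cs @ (n + 1) # es) \<longleftrightarrow>
      order_isomorphic (c # bs @ x # ds) (n # cs @ (n + 1) # es) \<and> (\<forall>z \<in> set (c # bs @ x # ds). z < M)"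
      using order_isomorphic_Cons_max[OF lt2] by simp
    also have "order_isomorphic (c # bs @ x # ds) (n # cs @ (n + 1) # es) \<longleftrightarrow>
      order_isomorphic (c # bs @ ds) (n # cs @ es) \<and> (\<forall>z \<in> set (c # bs @ ds). z < x)"
      using order_isomorphic_insert_max[OF _ lt1, of "c # bs" x ds] len by simp
    also have "order_isomorphic (c # bs @ ds) (n # cs @ es) \<longleftrightarrow>
      order_isomorphic (bs @ ds) (cs @ es) \<and> (\<forall>a \<in> set (bs @ ds). a < c)"
      using order_isomorphic_Cons_max[OF assms] by auto
    finally show ?thesis by (simp add: ball_Un) (meson less_trans)
  qed
  show ?thesis
  proof
    assume L: ?L
    then have "order_isomorphic xs (((n + 2) # n # cs) @ (n + 1) # es)" by simp
    then obtain as x ds where "xs = as @ x # ds" "length as = length ((n + 2) # n # cs)"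
      by (rule order_isomorphic_split)
    moreover from this obtain M c bs where "as = M # c # bs" "length bs = length cs"
      by (metis length_Suc_conv length_Cons)
    ultimately show ?R using L ins by auto
  qed (use ins in auto)
qed

lemma shuffles_singleton_iff:
  "\<tau> \<in> shuffles [y] ys \<longleftrightarrow> (\<exists>cs es. \<tau> = cs @ y # es \<and> ys = cs @ es)"
proof (induction ys arbitrary: \<tau>)
  case (Cons a ys)
  have "\<tau> \<in> shuffles [y] (a # ys) \<longleftrightarrow>
      \<tau> = y # a # ys \<or> (\<exists>cs es. \<tau> = a # cs @ y # es \<and> ys = cs @ es)"
    using Cons.IH by auto
  also have "\<dots> \<longleftrightarrow> (\<exists>cs es. \<tau> = cs @ y # es \<and> a # ys = cs @ es)"
    unfolding Cons_eq_append_conv by (metis append_Cons append_Nil)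
  finally show ?case .
qed auto

text \<open>The two outcomes of \<open>PSB_subseqD\<close> are occurrences of
  \<open>n # (n + 1) # \<alpha>\<close> and of \<open>(n + 2) # n # \<tau>\<close>, where
  \<open>bs \<noteq> []\<close> becomes \<open>\<tau> \<noteq> (n + 1) # \<alpha>\<close>. The two
  \<open>PSB_subseqI\<close> lemmas for popped and bypassed entries give the other
  direction.\<close>

lemma contains_pattern_PSB_Cons_max:
  assumes \<pi>: "\<pi> \<in> perms" and ne: "\<alpha> \<noteq> []" and max: "\<forall>z \<in> set \<alpha>. z < n"
  shows "contains_pattern (PSB \<pi>) (n # \<alpha>) \<longleftrightarrow>
    (\<exists>\<tau> \<in> {n # (n + 1) # \<alpha>} \<union>
      {(n + 2) # n # \<tau> | \<tau>. \<tau> \<in> shuffles [n + 1] \<alpha> \<and> \<tau> \<noteq> (n + 1) # \<alpha>}. contains_pattern \<pi> \<tau>)"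
    (is "?L \<longleftrightarrow> ?R")
proof
  have dist: "distinct \<pi>" using \<pi> by (auto simp: perms_iff)
  {
    assume ?L
    then obtain c as where as: "subseq (c # as) (PSB \<pi>)" "order_isomorphic as \<alpha>" "\<forall>a \<in> set as. a < c"
      unfolding contains_pattern_def order_isomorphic_Cons_max[OF max] by auto
    have ne': "as \<noteq> []" using as(2) ne by (auto simp: order_isomorphic_def)
    from \<pi> ne' as(3,1) show ?R
    proof (cases rule: PSB_subseqD)
      case (popped c' M)
      \<comment> \<open>Because \<open>c \<le> c'\<close>, the replacement still dominates
        \<open>as\<close>.\<close>
      then have "order_isomorphic (c' # M # as) (n # (n + 1) # \<alpha>)"
        unfolding order_isomorphic_231_iff[OF max] using as by force
      then show ?thesis using popped by (auto simp: contains_pattern_def)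
    next
      case (bypassed M x bs ds)
      \<comment> \<open>The length of \<open>bs\<close> is the position at which
        \<open>n + 1\<close> is inserted into \<open>\<alpha>\<close>.\<close>
      define cs es where "cs = take (length bs) \<alpha>" and "es = drop (length bs) \<alpha>"
      have \<alpha>: "\<alpha> = cs @ es" by (simp add: cs_def es_def)
      have len: "length bs = length cs"
        using order_isomorphic_length[OF as(2)] bypassed(1) by (simp add: cs_def)
      have "order_isomorphic (M # c # bs @ x # ds) ((n + 2) # n # cs @ (n + 1) # es)"
        using order_isomorphic_4213_iff[of cs es n] max as bypassed len unfolding \<alpha> by auto
      then have "contains_pattern \<pi> ((n + 2) # n # cs @ (n + 1) # es)"
        using bypassed by (auto simp: contains_pattern_def)
      \<comment> \<open>The word \<open>cs\<close> is nonempty and starts below \<open>n\<close>, so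
        the shuffle does not start with \<open>n + 1\<close>.\<close>
      moreover have "cs @ (n + 1) # es \<noteq> (n + 1) # \<alpha>"
        using bypassed(2) len max \<alpha> by (cases cs) auto
      moreover have "cs @ (n + 1) # es \<in> shuffles [n + 1] \<alpha>"
        using \<alpha> by (auto simp: shuffles_singleton_iff)
      ultimately show ?thesis by blast
    qed
  }
  have concl: ?L if "subseq (c # as) (PSB \<pi>)" "order_isomorphic as \<alpha>" "\<forall>a \<in> set as. a < c" for c as
    unfolding contains_pattern_def order_isomorphic_Cons_max[OF max] using that by blast
  assume ?R
  then consider "contains_pattern \<pi> (n # (n + 1) # \<alpha>)"
    | cs es where "contains_pattern \<pi> ((n + 2) # n # cs @ (n + 1) # es)" "\<alpha> = cs @ es"
    by (auto simp: shuffles_singleton_iff)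
  then show ?L
  proof cases
    case 1
    then obtain c M as where "subseq (c # M # as) \<pi>" "order_isomorphic as \<alpha>"
      "\<forall>a \<in> set as. a < c" "c < M"
      unfolding contains_pattern_def order_isomorphic_231_iff[OF max] by auto
    then show ?thesis using PSB_subseqI_popped[OF dist] concl by blast
  next
    case 2
    then obtain M c bs x ds where "subseq (M # c # bs @ x # ds) \<pi>"
      "order_isomorphic (bs @ ds) (cs @ es)" "\<forall>a \<in> set (bs @ ds). a < c" "c < x" "x < M"
      using order_isomorphic_4213_iff[of cs es n] max unfolding contains_pattern_def by auto
    then show ?thesis using PSB_subseqI_bypassed[OF dist] concl 2(2) by blast
  qed
qed

section \<open>Preimages for patterns with a leading or an appended maximum\<close>

lemma PSB_preimage_Av_singleton:
  "PSB_preimage (Av {\<rho>}) = {\<pi> \<in> perms. \<not> contains_pattern (PSB \<pi>) \<rho>}"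
  by (auto simp: PSB_preimage_def Av_def PSB_perms)

text \<open>An occurrence of \<open>\<beta>\<close> misses the final maximum of the output because
  \<open>\<beta>\<close> does not end in its own maximum, so that entry can be appended to it.
  Dropping the last entry gives the converse.\<close>

lemma contains_pattern_PSB_snoc_max:
  assumes \<pi>: "\<pi> \<in> perms" and \<beta>: "\<beta> \<in> perms" "\<beta> \<noteq> []" "last \<beta> \<noteq> length \<beta>"
  shows "contains_pattern (PSB \<pi>) (\<beta> @ [Suc (length \<beta>)]) \<longleftrightarrow> contains_pattern (PSB \<pi>) \<beta>"
    (is "?L \<longleftrightarrow> ?R")
proof
  have max: "\<forall>z \<in> set \<beta>. z < Suc (length \<beta>)"
    using perms_set_eq[OF \<beta>(1)] by auto
  {
    assume ?L
    then obtain as x where "subseq (as @ [x]) (PSB \<pi>)" "order_isomorphic as \<beta>"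
      unfolding contains_pattern_def order_isomorphic_snoc_max[OF max] by auto
    then show ?R
      unfolding contains_pattern_def by (intro exI[of _ as] conjI subseq_snocD[of as x])
  }
  assume ?R
  then obtain xs where xs: "subseq xs (PSB \<pi>)" "order_isomorphic xs \<beta>"
    by (auto simp: contains_pattern_def)
  have "xs \<noteq> []" using xs(2) \<beta>(2) by (auto simp: order_isomorphic_def)
  then have "\<pi> \<noteq> []" using xs(1) by (auto simp: PSB_def)
  then obtain \<sigma> where \<sigma>: "PSB \<pi> = \<sigma> @ [length \<pi>]" "\<forall>x \<in> set \<sigma>. x < length \<pi>"
    using PSB_ends_with_max[OF \<pi>] by blast
  obtain xs1 xs2 where split: "xs = xs1 @ xs2" "subseq xs1 \<sigma>" "subseq xs2 [length \<pi>]"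
    using xs(1) unfolding \<sigma>(1) by (rule subseq_appendE)
  have sub1: "set xs1 \<subseteq> set \<sigma>" using split(2) by (auto simp: subseq_conv_nths dest: in_set_nthsD)
  have "xs2 = []"
  proof (rule ccontr)
    assume "xs2 \<noteq> []"
    then have "xs2 = [length \<pi>]" using split(3) by (cases xs2) (auto split: if_splits)
    \<comment> \<open>Using the last output entry would make the occurrence end in its
      maximum.\<close>
    then have "\<forall>x \<in> set xs. x \<le> last xs" using sub1 split(1) \<sigma>(2) by (auto dest: less_imp_le)
    then have "\<forall>y \<in> set \<beta>. y \<le> last \<beta>"
      using order_isomorphic_last_max[OF xs(2) \<open>xs \<noteq> []\<close>] by simp
    moreover have "length \<beta> \<in> set \<beta>" "last \<beta> \<in> set \<beta>"
      using perms_set_eq[OF \<beta>(1)] \<beta>(2) by (auto simp: Suc_leI)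
    ultimately show False using \<beta>(3) max by (metis le_antisym less_Suc_eq_le)
  qed
  then have "subseq (xs @ [length \<pi>]) (PSB \<pi>)" "\<forall>z \<in> set xs. z < length \<pi>"
    using split sub1 \<sigma> by auto
  then show ?L
    unfolding contains_pattern_def order_isomorphic_snoc_max[OF max] using xs(2) by blast
qed

lemma PSB_preimage_Av_snoc_max:
  assumes "\<beta> \<in> perms" "\<beta> \<noteq> []" "last \<beta> \<noteq> length \<beta>"
  shows "PSB_preimage (Av {\<beta> @ [Suc (length \<beta>)]}) = PSB_preimage (Av {\<beta>})"
  using contains_pattern_PSB_snoc_max[OF _ assms] by (auto simp: PSB_preimage_Av_singleton)

lemma PSB_preimage_Av_Cons_max:
  assumes "\<alpha> \<noteq> []" "\<forall>z \<in> set \<alpha>. z < n"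
  shows "PSB_preimage (Av {n # \<alpha>}) =
    Av ({n # (n + 1) # \<alpha>} \<union>
      {(n + 2) # n # \<tau> | \<tau>. \<tau> \<in> shuffles [n + 1] \<alpha> \<and> \<tau> \<noteq> (n + 1) # \<alpha>})"
  using contains_pattern_PSB_Cons_max[OF _ assms]
  unfolding PSB_preimage_Av_singleton unfolding Av_def by blast

section \<open>Patterns of size two\<close>

lemma contains_12_or_21_iff:
  assumes "\<pi> \<in> perms"
  shows "contains_pattern \<pi> [1, 2] \<or> contains_pattern \<pi> [2, 1] \<longleftrightarrow> 2 \<le> length \<pi>"
proof
  assume "2 \<le> length \<pi>"
  then obtain x y zs where \<pi>: "\<pi> = x # y # zs"
    by (metis One_nat_def Suc_1 Suc_le_length_iff)
  then have "x < y \<or> y < x" using assms by (auto simp: perms_iff)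
  then have "order_isomorphic [x, y] [1, 2] \<or> order_isomorphic [x, y] [2, 1]"
    by (auto simp: order_isomorphic_zip)
  then show "contains_pattern \<pi> [1, 2] \<or> contains_pattern \<pi> [2, 1]"
    using \<pi> by (auto simp: contains_pattern_def)
qed (auto simp: contains_pattern_def dest!: order_isomorphic_length list_emb_length)

text \<open>The output keeps the length and ends in its maximum, so its first and last entries form
  12 once there are two entries.\<close>

lemma contains_12_PSB_iff:
  assumes "\<pi> \<in> perms"
  shows "contains_pattern (PSB \<pi>) [1, 2] \<longleftrightarrow> 2 \<le> length \<pi>"
proof
  assume len: "2 \<le> length \<pi>"
  then have "\<pi> \<noteq> []" by auto
  then obtain \<sigma> where \<sigma>: "PSB \<pi> = \<sigma> @ [length \<pi>]" "\<forall>x \<in> set \<sigma>. x < length \<pi>"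
    using PSB_ends_with_max[OF assms] by blast
  then obtain x \<sigma>' where x: "\<sigma> = x # \<sigma>'"
    using len length_PSB[of \<pi>] by (cases \<sigma>) auto
  have "subseq [x, length \<pi>] (PSB \<pi>)" unfolding \<sigma>(1) x by (simp add: list_emb_append2)
  moreover have "order_isomorphic [x, length \<pi>] [1, 2]"
    using \<sigma>(2) x by (auto simp: order_isomorphic_zip)
  ultimately show "contains_pattern (PSB \<pi>) [1, 2]"
    unfolding contains_pattern_def by blast
next
  assume "contains_pattern (PSB \<pi>) [1, 2]"
  then show "2 \<le> length \<pi>"
    by (auto simp: contains_pattern_def simp flip: length_PSB[of \<pi>]
        dest!: order_isomorphic_length list_emb_length)
qed

section \<open>Preimages that are not classes\<close>

text \<open>The preimage has \<open>\<pi>'\<close> as a member but not the contained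
  \<open>\<pi>\<close>. Later \<open>\<pi>'\<close> arises from \<open>\<pi>\<close> by inserting a
  new maximum.\<close>

lemma not_permutation_class_PSB_preimage:
  assumes "\<pi> \<in> perms" "\<pi>' \<in> perms" "subseq \<pi> \<pi>'"
    "contains_pattern (PSB \<pi>) \<rho>" "\<not> contains_pattern (PSB \<pi>') \<rho>"
  shows "\<not> permutation_class (PSB_preimage (Av {\<rho>}))"
proof -
  have "contains_pattern \<pi>' \<pi>"
    using assms(3) order_isomorphic_refl by (auto simp: contains_pattern_def)
  then show ?thesis
    using assms by (auto simp: permutation_class_def PSB_preimage_Av_singleton)
qed

lemma psb_fold_bypass:
  "\<forall>x \<in> set q. Suc x < t \<Longrightarrow> foldl psb_step (t # s, out) q = (t # s, out @ q)"
  by (induction q arbitrary: out) auto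

text \<open>Each left-to-right maximum of u is output by the arrival of the next one, so the input moves
  every such entry to the front of the block preceding it.\<close>

lemma psb_run_surj:
  assumes "distinct u" "\<forall>x \<in> set u. x < m"
  obtains w where "mset w = mset (u @ [m])" "psb_run w = ([m], u)"
proof -
  have "\<exists>w. mset w = mset (u @ [m]) \<and> psb_run w = ([m], u)"
    using assms
  proof (induction "length u" arbitrary: u m rule: less_induct)
    case less
    show ?case
    proof (cases "u = []")
      case True
      then show ?thesis by (intro exI[of _ "[m]"]) simp
    next
      case False
      define k where "k = Max (set u)"
      have "k \<in> set u" unfolding k_def using False by simp
      then obtain us vs where u: "u = us @ k # vs" by (auto dest: split_list)
      have lt: "x < k" if "x \<in> set us \<union> set vs" for x
      proof -
        have "x \<le> k" unfolding k_def by (rule Max_ge) (use that u in auto)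
        moreover have "x \<noteq> k" using that less.prems(1) u by auto
        ultimately show ?thesis by simp
      qed
      obtain w where w: "mset w = mset (us @ [k])" "psb_run w = ([k], us)"
        using less.hyps[of us k] less.prems u lt by auto
      have "k < m" using less.prems u by simp
      then have "\<forall>x \<in> set vs. Suc x < m" using lt by fastforce
      then have "psb_run (w @ m # vs) = ([m], u)"
        using w(2) \<open>k < m\<close> u psb_fold_bypass[of vs m "[]" "us @ [k]"] by simp
      moreover have "mset (w @ m # vs) = mset (u @ [m])" using w(1) u by simp
      ultimately show ?thesis by blast
    qed
  qed
  then show thesis using that by blast
qed

lemma subseq_singletonD: "subseq xs [y] \<Longrightarrow> xs = [] \<or> xs = [y]"
  by (cases xs) (auto split: if_splits)

lemma subseq_snoc_snocD:
  assumes "subseq (xs @ [x]) (ys @ [y])"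
  shows "subseq xs ys"
proof -
  obtain as bs where split: "xs @ [x] = as @ bs" "subseq as ys" "subseq bs [y]"
    using assms by (rule subseq_appendE)
  from subseq_singletonD[OF split(3)] show ?thesis
  proof
    assume "bs = []"
    then show ?thesis using split by (auto dest: subseq_snocD)
  qed (use split in simp)
qed

text \<open>Let \<open>g\<close> be the entry just before the maximum \<open>m\<close> of
  \<open>\<beta>\<close>; it exists because \<open>m\<close> is not first. An input with output
  \<open>\<beta> @ [Suc m]\<close> is built, and inserting \<open>Suc (Suc m)\<close> forces a pop
  after which \<open>m\<close> leaves before \<open>g\<close>, destroying every occurrence. The
  construction depends on whether \<open>m\<close> ends \<open>\<beta>\<close>.\<close>

lemma not_permutation_class_snoc_max:
  assumes \<beta>: "\<beta> \<in> perms" "\<beta> \<noteq> []" "hd \<beta> \<noteq> length \<beta>"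
  shows "\<not> permutation_class (PSB_preimage (Av {\<beta> @ [Suc (length \<beta>)]}))"
proof -
  define m where "m = length \<beta>"
  have set\<beta>: "set \<beta> = {1..m}" and dist: "distinct \<beta>"
    using \<beta>(1) perms_set_eq[OF \<beta>(1)] by (auto simp: m_def perms_iff)
  have "m \<in> set \<beta>" using set\<beta> \<beta>(2) by (auto simp: m_def Suc_leI)
  then obtain \<gamma>0 \<delta> where "\<beta> = \<gamma>0 @ m # \<delta>" by (auto dest: split_list)
  moreover from this have "\<gamma>0 \<noteq> []" using \<beta>(3) unfolding m_def by (metis append_Nil list.sel(1))
  ultimately obtain \<gamma> g where \<beta>_eq: "\<beta> = \<gamma> @ g # m # \<delta>"
    by (metis append.assoc append_Cons append_Nil rev_exhaust)
  have lt: "x < m" if "x \<in> set (\<gamma> @ g # \<delta>)" for x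
  proof -
    have "x \<in> set \<beta>" using that unfolding \<beta>_eq by auto
    then have "x \<le> m" unfolding set\<beta> by simp
    moreover have "x \<noteq> m" using that dist unfolding \<beta>_eq by auto
    ultimately show ?thesis by simp
  qed
  have max: "\<forall>z \<in> set \<beta>. z < Suc m" using set\<beta> by auto
  have Sm: "{1..Suc m} = insert (Suc m) {1..m}" "{1..Suc (Suc m)} = insert (Suc (Suc m)) {1..Suc m}"
    by auto
  have perm1: "\<pi> \<in> perms" if "mset \<pi> = mset (\<beta> @ [Suc m])" for \<pi>
    using mset_eq_setD[OF that] mset_eq_imp_distinct_iff[OF that] dist set\<beta> Sm
    by (auto simp: perms_iff intro!: exI[of _ "Suc m"])
  have perm2: "\<pi> \<in> perms" if "mset \<pi> = mset (\<beta> @ [Suc m, Suc (Suc m)])" for \<pi>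
    using mset_eq_setD[OF that] mset_eq_imp_distinct_iff[OF that] dist set\<beta> Sm
    by (auto simp: perms_iff intro!: exI[of _ "Suc (Suc m)"])
  have self: "contains_pattern (PSB \<pi>) (\<beta> @ [Suc m])" if "PSB \<pi> = \<beta> @ [Suc m]" for \<pi>
    using that order_isomorphic_refl by (auto simp: contains_pattern_def)
  \<comment> \<open>An occurrence without its last entry embeds in the output without its last
    entry, so it is enough that \<open>\<sigma>\<close> has no occurrence of
    \<open>\<beta>\<close>.\<close>
  have avoid: "\<not> contains_pattern (\<sigma> @ [X]) (\<beta> @ [Suc m])"
    if "\<And>as. subseq as \<sigma> \<Longrightarrow> order_isomorphic as \<beta> \<Longrightarrow> False" for \<sigma> X
  proof
    assume "contains_pattern (\<sigma> @ [X]) (\<beta> @ [Suc m])"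
    then obtain as x where "subseq (as @ [x]) (\<sigma> @ [X])" "order_isomorphic as \<beta>"
      unfolding contains_pattern_def order_isomorphic_snoc_max[OF max] by auto
    then show False using that[of as] subseq_snoc_snocD[of as x \<sigma> X] by simp
  qed
  have lastD: "(\<forall>a \<in> set as. a \<le> last as) \<longleftrightarrow> (\<forall>y \<in> set \<beta>. y \<le> last \<beta>)"
    if "order_isomorphic as \<beta>" for as
    using that order_isomorphic_last_max[OF that] \<beta>(2) by (cases "as = []") (auto simp: order_isomorphic_def)
  show ?thesis
  proof (cases "\<delta> = []")
    case True
    have "distinct \<gamma>" "\<forall>x \<in> set \<gamma>. x < Suc m" using dist \<beta>_eq lt by (auto simp: less_SucI)
    then obtain w where w: "mset w = mset (\<gamma> @ [Suc m])" "psb_run w = ([Suc m], \<gamma>)"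
      by (rule psb_run_surj)
    have "g < m" using lt by simp
    \<comment> \<open>The entry \<open>m\<close> is pushed onto \<open>Suc m\<close>;
      \<open>g\<close> then precedes \<open>m\<close> both when pushed and when bypassing.\<close>
    have out1: "PSB (w @ [m, g]) = \<beta> @ [Suc m]"
      using w(2) \<open>g < m\<close> \<beta>_eq True by (cases "Suc g = m") (auto simp: PSB_def)
    \<comment> \<open>Now \<open>Suc (Suc m)\<close> pops \<open>Suc m\<close>, and the gap in
      values below it makes both \<open>m\<close> and \<open>g\<close> bypass.\<close>
    have out2: "PSB (w @ [Suc (Suc m), m, g]) = (\<gamma> @ [Suc m, m, g]) @ [Suc (Suc m)]"
      using w(2) \<open>g < m\<close> by (simp add: PSB_def)
    have "\<not> contains_pattern (PSB (w @ [Suc (Suc m), m, g])) (\<beta> @ [Suc m])"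
      unfolding out2
    proof (rule avoid)
      fix as assume as: "subseq as (\<gamma> @ [Suc m, m, g])" "order_isomorphic as \<beta>"
      have len: "length as = length \<gamma> + 2" using order_isomorphic_length[OF as(2)] \<beta>_eq True by simp
      have asmax: "\<forall>a \<in> set as. a \<le> last as"
        using lastD[OF as(2)] \<beta>_eq True max by (auto simp: less_Suc_eq_le)
      have "subseq as ((\<gamma> @ [Suc m, m]) @ [g])" using as(1) by simp
      then obtain xs1 xs2 where xs: "as = xs1 @ xs2" "subseq xs1 (\<gamma> @ [Suc m, m])" "subseq xs2 [g]"
        by (rule subseq_appendE)
      from subseq_singletonD[OF xs(3)] show False
      proof
        assume "xs2 = []"
        \<comment> \<open>Without \<open>g\<close> the length leaves no choice, and the word ends in
          \<open>m\<close> although it contains \<open>Suc m\<close>.\<close>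
        then have "as = \<gamma> @ [Suc m, m]" using xs len by (intro subseq_same_length) auto
        then show False using asmax by simp
      next
        assume "xs2 = [g]"
        then have "\<forall>a \<in> set xs1. a \<le> g" using asmax xs(1) by simp
        then have "subseq xs1 (filter (\<lambda>a. a \<le> g) (\<gamma> @ [Suc m, m]))"
          using xs(2) subseq_filter_iff[of xs1 "\<lambda>a. a \<le> g"] by blast
        then have "length xs1 \<le> length (filter (\<lambda>a. a \<le> g) (\<gamma> @ [Suc m, m]))"
          by (rule list_emb_length)
        also have "\<dots> \<le> length \<gamma>" using \<open>g < m\<close> by simp
        finally show False using len xs(1) \<open>xs2 = [g]\<close> by simp
      qed
    qed
    moreover have "w @ [m, g] \<in> perms" by (rule perm1) (simp add: w(1) \<beta>_eq True)
    moreover have "w @ [Suc (Suc m), m, g] \<in> perms" by (rule perm2) (simp add: w(1) \<beta>_eq True)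
    moreover have "subseq (w @ [m, g]) (w @ [Suc (Suc m), m, g])" by (simp add: subseq_append')
    ultimately show ?thesis
      using not_permutation_class_PSB_preimage self[OF out1] by (simp add: m_def)
  next
    case False
    have "distinct \<gamma>" "\<forall>x \<in> set \<gamma>. x < m" using dist \<beta>_eq lt by auto
    then obtain w where w: "mset w = mset (\<gamma> @ [m])" "psb_run w = ([m], \<gamma>)"
      by (rule psb_run_surj)
    have "g < m" using lt by simp
    have \<delta>: "\<forall>x \<in> set \<delta>. Suc x < Suc m" using lt by auto
    \<comment> \<open>Here \<open>g\<close> bypasses \<open>m\<close> or is pushed onto it; either
      way \<open>Suc m\<close> then flushes the stack and \<open>\<delta>\<close> bypasses.\<close>
    have out1: "PSB (w @ g # Suc m # \<delta>) = \<beta> @ [Suc m]"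
      using w(2) \<open>g < m\<close> \<beta>_eq psb_fold_bypass[OF \<delta>] by (cases "Suc g = m") (auto simp: PSB_def)
    \<comment> \<open>The new maximum flushes \<open>m\<close> before \<open>g\<close> arrives, and
      \<open>Suc m\<close> is then pushed onto it instead of causing a pop.\<close>
    have out2: "PSB (w @ Suc (Suc m) # g # Suc m # \<delta>) = (\<gamma> @ m # g # \<delta> @ [Suc m]) @ [Suc (Suc m)]"
      using w(2) \<open>g < m\<close> psb_fold_bypass[OF \<delta>] by (simp add: PSB_def)
    have "\<not> contains_pattern (PSB (w @ Suc (Suc m) # g # Suc m # \<delta>)) (\<beta> @ [Suc m])"
      unfolding out2
    proof (rule avoid)
      fix as assume as: "subseq as (\<gamma> @ m # g # \<delta> @ [Suc m])" "order_isomorphic as \<beta>"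
      have len: "length as = length \<beta>" using order_isomorphic_length[OF as(2)] .
      have "subseq as ((\<gamma> @ m # g # \<delta>) @ [Suc m])" using as(1) by simp
      then obtain xs1 xs2 where xs: "as = xs1 @ xs2" "subseq xs1 (\<gamma> @ m # g # \<delta>)" "subseq xs2 [Suc m]"
        by (rule subseq_appendE)
      have sub1: "set xs1 \<subseteq> set (\<gamma> @ m # g # \<delta>)"
        using xs(2) by (auto simp: subseq_conv_nths dest: in_set_nthsD)
      from subseq_singletonD[OF xs(3)] show False
      proof
        assume "xs2 = []"
        \<comment> \<open>Without \<open>Suc m\<close> the occurrence is a whole rearrangement of
          \<open>\<beta>\<close>, hence equal to \<open>\<beta>\<close>, which would give
          \<open>m = g\<close>.\<close>
        then have "as = \<gamma> @ m # g # \<delta>" using xs len \<beta>_eq by (intro subseq_same_length) auto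
        then have "\<gamma> @ m # g # \<delta> = \<beta>"
          using order_isomorphic_perm_eq[OF as(2)] dist \<beta>_eq by (auto simp: insert_commute)
        then show False using \<beta>_eq \<open>g < m\<close> by simp
      next
        assume "xs2 = [Suc m]"
        \<comment> \<open>Using \<open>Suc m\<close> puts the maximum last, whereas
          \<open>\<beta>\<close> ends inside the nonempty \<open>\<delta>\<close>, below
          \<open>m\<close>.\<close>
        then have "\<forall>a \<in> set as. a \<le> last as" using xs(1) sub1 lt by fastforce
        then have "\<forall>y \<in> set \<beta>. y \<le> last \<beta>" using lastD[OF as(2)] by simp
        then have "m \<le> last \<delta>" using \<beta>_eq False by simp
        then show False using lt[of "last \<delta>"] False by simp
      qed
    qed
    moreover have "w @ g # Suc m # \<delta> \<in> perms" by (rule perm1) (simp add: w(1) \<beta>_eq)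
    moreover have "w @ Suc (Suc m) # g # Suc m # \<delta> \<in> perms" by (rule perm2) (simp add: w(1) \<beta>_eq)
    moreover have "subseq (w @ g # Suc m # \<delta>) (w @ Suc (Suc m) # g # Suc m # \<delta>)"
      by (simp add: subseq_append')
    ultimately show ?thesis
      using not_permutation_class_PSB_preimage self[OF out1] by (simp add: m_def)
  qed
qed

section \<open>Classification by the positions of the largest entries\<close>

theorem proposition4p1:
  fixes \<rho> :: "nat list"
  assumes "\<rho> \<in> perms"
  shows "(\<rho> = [] \<longrightarrow> PSB_preimage (Av {\<rho>}) = Av {[]}) \<and>
    (\<rho> = [1] \<longrightarrow> PSB_preimage (Av {\<rho>}) = Av {[1]}) \<and>
    (\<rho> = [1, 2] \<longrightarrow> PSB_preimage (Av {\<rho>}) = Av {[1, 2], [2, 1]}) \<and>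
    (\<forall>n \<alpha>. \<alpha> \<in> permutations_of_set {1..n - 1} \<and> \<alpha> \<noteq> [] \<and> \<rho> = n # \<alpha> \<longrightarrow>
       PSB_preimage (Av {\<rho>}) =
         Av ({n # (n + 1) # \<alpha>} \<union>
             {(n + 2) # n # \<tau> | \<tau>. \<tau> \<in> shuffles [n + 1] \<alpha> \<and> \<tau> \<noteq> (n + 1) # \<alpha>})) \<and>
    (\<forall>n \<alpha>. \<alpha> \<in> permutations_of_set {1..n - 2} \<and> \<alpha> \<noteq> [] \<and> \<rho> = (n - 1) # \<alpha> @ [n] \<longrightarrow>
       PSB_preimage (Av {\<rho>}) =
         Av ({(n - 1) # n # \<alpha>} \<union>
             {(n + 1) # (n - 1) # \<tau> | \<tau>. \<tau> \<in> shuffles [n] \<alpha> \<and> \<tau> \<noteq> n # \<alpha>})) \<and>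
    (\<rho> \<notin> {[], [1], [1, 2]} \<and>
     \<not> (\<exists>n \<alpha>. \<alpha> \<in> permutations_of_set {1..n - 1} \<and> \<alpha> \<noteq> [] \<and> \<rho> = n # \<alpha>) \<and>
     \<not> (\<exists>n \<alpha>. \<alpha> \<in> permutations_of_set {1..n - 2} \<and> \<alpha> \<noteq> [] \<and> \<rho> = (n - 1) # \<alpha> @ [n]) \<longrightarrow>
       \<not> permutation_class (PSB_preimage (Av {\<rho>})))"
proof (intro conjI allI impI)
  assume "\<rho> = []"
  moreover have "contains_pattern \<pi> []" for \<pi>
    by (auto simp: contains_pattern_def order_isomorphic_def)
  ultimately show "PSB_preimage (Av {\<rho>}) = Av {[]}"
    unfolding PSB_preimage_Av_singleton by (simp add: Av_def)
next
  assume "\<rho> = [1]"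
  moreover have "contains_pattern \<pi> [1] \<longleftrightarrow> \<pi> \<noteq> []" for \<pi>
  proof
    assume "\<pi> \<noteq> []"
    then have "subseq [hd \<pi>] \<pi>" "order_isomorphic [hd \<pi>] [1]"
      by (simp_all add: subseq_singleton_left order_isomorphic_def)
    then show "contains_pattern \<pi> [1]" unfolding contains_pattern_def by blast
  qed (auto simp: contains_pattern_def order_isomorphic_def)
  moreover have "PSB \<pi> = [] \<longleftrightarrow> \<pi> = []" for \<pi>
    using length_PSB[of \<pi>] by (metis length_0_conv)
  ultimately show "PSB_preimage (Av {\<rho>}) = Av {[1]}"
    unfolding PSB_preimage_Av_singleton by (simp add: Av_def)
next
  assume \<rho>: "\<rho> = [1, 2]"
  have "contains_pattern (PSB \<pi>) [1, 2] \<longleftrightarrow> contains_pattern \<pi> [1, 2] \<or> contains_pattern \<pi> [2, 1]"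
    if "\<pi> \<in> perms" for \<pi>
    using contains_12_or_21_iff[OF that] contains_12_PSB_iff[OF that] by simp
  then show "PSB_preimage (Av {\<rho>}) = Av {[1, 2], [2, 1]}"
    unfolding \<rho> PSB_preimage_Av_singleton unfolding Av_def by auto
next
  fix n \<alpha>
  assume A: "\<alpha> \<in> permutations_of_set {1..n - 1} \<and> \<alpha> \<noteq> [] \<and> \<rho> = n # \<alpha>"
  then have "\<forall>z \<in> set \<alpha>. z < n" by (auto simp: permutations_of_set_def)
  then show "PSB_preimage (Av {\<rho>}) =
      Av ({n # (n + 1) # \<alpha>} \<union>
        {(n + 2) # n # \<tau> | \<tau>. \<tau> \<in> shuffles [n + 1] \<alpha> \<and> \<tau> \<noteq> (n + 1) # \<alpha>})"
    using A PSB_preimage_Av_Cons_max by blast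
next
  fix n \<alpha>
  assume A: "\<alpha> \<in> permutations_of_set {1..n - 2} \<and> \<alpha> \<noteq> [] \<and> \<rho> = (n - 1) # \<alpha> @ [n]"
  then have \<alpha>: "set \<alpha> = {1..n - 2}" "distinct \<alpha>" "\<alpha> \<noteq> []" by (auto simp: permutations_of_set_def)
  \<comment> \<open>A nonempty \<open>\<alpha>\<close> forces \<open>n \<ge> 3\<close>, so
    \<open>n - 1\<close> and \<open>n - 2\<close> are not truncated.\<close>
  obtain k where n: "n = Suc (Suc (Suc k))"
    using \<alpha>(1,3) by (cases n rule: nat.exhaust; cases "n - 1"; cases "n - 2") auto
  have lt: "\<forall>z \<in> set \<alpha>. z < n - 1" using \<alpha>(1) n by auto
  define \<beta> where "\<beta> = (n - 1) # \<alpha>"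
  have len: "length \<alpha> = n - 2" using distinct_card[OF \<alpha>(2)] unfolding \<alpha>(1) by simp
  have "\<beta> \<in> perms"
    unfolding perms_iff \<beta>_def using \<alpha> n by (intro exI[of _ "n - 1"]) auto
  moreover have "last \<alpha> < n - 1" using lt last_in_set[OF \<alpha>(3)] by blast
  then have "last \<beta> \<noteq> length \<beta>" using \<alpha>(3) len n by (simp add: \<beta>_def)
  moreover have "\<rho> = \<beta> @ [Suc (length \<beta>)]" using A len n by (simp add: \<beta>_def)
  \<comment> \<open>The appended maximum leaves the preimage unchanged, so the case of a leading
    maximum applies with \<open>n - 1\<close> for \<open>n\<close>.\<close>
  ultimately have "PSB_preimage (Av {\<rho>}) = PSB_preimage (Av {\<beta>})"
    using PSB_preimage_Av_snoc_max[of \<beta>] by (simp add: \<beta>_def)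
  then show "PSB_preimage (Av {\<rho>}) =
      Av ({(n - 1) # n # \<alpha>} \<union>
        {(n + 1) # (n - 1) # \<tau> | \<tau>. \<tau> \<in> shuffles [n] \<alpha> \<and> \<tau> \<noteq> n # \<alpha>})"
    using PSB_preimage_Av_Cons_max[OF \<alpha>(3) lt] n by (simp add: \<beta>_def)
next
  assume A: "\<rho> \<notin> {[], [1], [1, 2]} \<and>
     \<not> (\<exists>n \<alpha>. \<alpha> \<in> permutations_of_set {1..n - 1} \<and> \<alpha> \<noteq> [] \<and> \<rho> = n # \<alpha>) \<and>
     \<not> (\<exists>n \<alpha>. \<alpha> \<in> permutations_of_set {1..n - 2} \<and> \<alpha> \<noteq> [] \<and> \<rho> = (n - 1) # \<alpha> @ [n])"
  have set\<rho>: "set \<rho> = {1..length \<rho>}" and dist: "distinct \<rho>"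
    using assms perms_set_eq[OF assms] by (auto simp: perms_iff)
  have tail: "\<alpha> \<in> permutations_of_set {1..k}" if "set (Suc k # \<alpha>) = {1..Suc k}" "distinct (Suc k # \<alpha>)"
    for k \<alpha>
  proof -
    have "set \<alpha> = set (Suc k # \<alpha>) - {Suc k}" using that(2) by auto
    also have "\<dots> = {1..k}" unfolding that(1) by auto
    finally show ?thesis using that(2) by (simp add: permutations_of_set_def)
  qed
  \<comment> \<open>A leading maximum would make \<open>\<rho>\<close> equal to \<open>[1]\<close>
    or to some excluded \<open>n # \<alpha>\<close>.\<close>
  have hd\<rho>: "hd \<rho> \<noteq> length \<rho>"
  proof
    assume h: "hd \<rho> = length \<rho>"
    obtain \<alpha> where \<rho>: "\<rho> = Suc (length \<alpha>) # \<alpha>" using h A by (cases \<rho>) auto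
    have "\<alpha> \<in> permutations_of_set {1..Suc (length \<alpha>) - 1}"
      using tail[of "length \<alpha>" \<alpha>] set\<rho> dist unfolding \<rho> by simp
    moreover have "\<alpha> \<noteq> []" using A \<rho> by auto
    ultimately show False using A \<rho> by blast
  qed
  show "\<not> permutation_class (PSB_preimage (Av {\<rho>}))"
  proof (cases "last \<rho> = length \<rho>")
    case False
    \<comment> \<open>The preimage is also that of \<open>\<rho> @ [Suc (length \<rho>)]\<close>, to
      which the failure lemma applies.\<close>
    then show ?thesis
      using not_permutation_class_snoc_max[OF assms _ hd\<rho>] PSB_preimage_Av_snoc_max[OF assms] A
      by simp
  next
    case True
    define \<beta> where "\<beta> = butlast \<rho>"
    have \<rho>: "\<rho> = \<beta> @ [Suc (length \<beta>)]"
      using A True append_butlast_last_id[of \<rho>] by (simp add: \<beta>_def)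
    have "set \<beta> = set \<rho> - {Suc (length \<beta>)}" using dist unfolding \<rho> by auto
    also have "\<dots> = {1..length \<beta>}" unfolding set\<rho> by (auto simp: \<rho>)
    finally have set\<beta>: "set \<beta> = {1..length \<beta>}" .
    then have "\<beta> \<in> perms" unfolding perms_iff using dist \<rho> by auto
    moreover have "\<beta> \<noteq> []" using A \<rho> by auto
    \<comment> \<open>Equality would make \<open>\<rho>\<close> either \<open>[1, 2]\<close> or
      \<open>(n - 1) # \<alpha> @ [n]\<close> with \<open>n = Suc (Suc (length \<alpha>))\<close>,
      both excluded.\<close>
    moreover have "hd \<beta> \<noteq> length \<beta>"
    proof
      assume h: "hd \<beta> = length \<beta>"
      then obtain \<alpha> where \<beta>: "\<beta> = Suc (length \<alpha>) # \<alpha>" using \<open>\<beta> \<noteq> []\<close> by (cases \<beta>) auto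
      have "\<alpha> \<in> permutations_of_set {1..length \<alpha>}"
        using tail[of "length \<alpha>" \<alpha>] set\<beta> dist unfolding \<rho> \<beta> by simp
      moreover have "\<alpha> \<noteq> []" using A \<rho> \<beta> by auto
      moreover have "\<rho> = (Suc (Suc (length \<alpha>)) - 1) # \<alpha> @ [Suc (Suc (length \<alpha>))]"
        using \<rho> \<beta> by simp
      moreover have "length \<alpha> = Suc (Suc (length \<alpha>)) - 2" by simp
      ultimately show False using A by metis
    qed
    ultimately show ?thesis using not_permutation_class_snoc_max[of \<beta>] \<rho> by simp
  qed
qed

end
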